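(* Let $V$ be a separable infinite-dimensional right quaternionic Hilbert space and let $T\in\mathcal{B}(V)$. Then $$\sigma_e^S(T)\subset\sigma_S(T)\setminus\sigma_d^S(T),$$ where $\sigma_d^S(T)$ denotes the set of all right eigenvalues of $T$ of finite type.
   Context: $\mathbb{H}$ is the skew field of quaternions and $[q]=\{hqh^{-1}: h\in\mathbb{H}\setminus\{0\}\}$ for $q\in\mathbb{H}$. A right quaternionic Hilbert space $V$ is a right $\mathbb{H}$-vector space with an $\mathbb{H}$-valued inner product satisfying $\langle f,gq+h\rangle=\langle f,g\rangle q+\langle f,h\rangle$, $\langle f,g\rangle=\overline{\langle g,f\rangle}$, $\langle f,f\rangle\ge 0$ with equality only for $f=0$, and complete for $\|f\|=\sqrt{\langle f,f\rangle}$. $\mathcal{B}(V)$ is the set of bounded right $\mathbb{H}$-linear operators on $V$ and $\mathcal{K}(V)$ the closed two-sided ideal of compact ones. For $T\in\mathcal{B}(V)$ and $q\in\mathbb{H}$, $Q_q(T):=T^2-2\operatorname{Re}(q)T+|q|^2\mathbb{I}_V$. The $S$-spectrum $\sigma_S(T)$ is the set of $q\in\mathbb{H}$ such that $Q_q(T)$ is not invertible in $\mathcal{B}(V)$ (same definition for operators on closed subspaces). The essential $S$-spectrum $\sigma_e^S(T)$ is the set of $q\in\mathbb{H}$ such that the class of $Q_q(T)$ is not invertible in the Calkin algebra $\mathcal{B}(V)/\mathcal{K}(V)$. A point $q\in\sigma_S(T)$ is a (right) eigenvalue of finite type of $T$ if $V$ is a direct sum $V=V_1\oplus V_2$ of closed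 $T$-invariant right subspaces such that $\dim V_1<\infty$, $\sigma_S(T|_{V_1})\cap\sigma_S(T|_{V_2})=\emptyset$ and $\sigma_S(T|_{V_1})=[q]$. *)

theory Defs
  imports "HOL-Analysis.Analysis" "HOL-Algebra.QuotRing"
begin

section \<open>Quaternions\<close>

codatatype quat = Quat (qRe: real) (qIm1: real) (qIm2: real) (qIm3: real)

lemma quat_eq_iff:
  "x = y \<longleftrightarrow> qRe x = qRe y \<and> qIm1 x = qIm1 y \<and> qIm2 x = qIm2 y \<and> qIm3 x = qIm3 y"
  by (auto intro: quat.expand)

instantiation quat :: ab_group_add
begin

primcorec zero_quat where
  "qRe 0 = 0" | "qIm1 0 = 0" | "qIm2 0 = 0" | "qIm3 0 = 0"

primcorec plus_quat where
  "qRe (x + y) = qRe x + qRe y"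
| "qIm1 (x + y) = qIm1 x + qIm1 y"
| "qIm2 (x + y) = qIm2 x + qIm2 y"
| "qIm3 (x + y) = qIm3 x + qIm3 y"

primcorec uminus_quat where
  "qRe (- x) = - qRe x"
| "qIm1 (- x) = - qIm1 x"
| "qIm2 (- x) = - qIm2 x"
| "qIm3 (- x) = - qIm3 x"

primcorec minus_quat where
  "qRe (x - y) = qRe x - qRe y"
| "qIm1 (x - y) = qIm1 x - qIm1 y"
| "qIm2 (x - y) = qIm2 x - qIm2 y"
| "qIm3 (x - y) = qIm3 x - qIm3 y"

instance
  by standard (simp_all add: quat_eq_iff)

end

instantiation quat :: real_algebra_1
begin

primcorec one_quat where
  "qRe 1 = 1" | "qIm1 1 = 0" | "qIm2 1 = 0" | "qIm3 1 = 0"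

primcorec times_quat where
  "qRe (x * y) = qRe x * qRe y - qIm1 x * qIm1 y - qIm2 x * qIm2 y - qIm3 x * qIm3 y"
| "qIm1 (x * y) = qRe x * qIm1 y + qIm1 x * qRe y + qIm2 x * qIm3 y - qIm3 x * qIm2 y"
| "qIm2 (x * y) = qRe x * qIm2 y - qIm1 x * qIm3 y + qIm2 x * qRe y + qIm3 x * qIm1 y"
| "qIm3 (x * y) = qRe x * qIm3 y + qIm1 x * qIm2 y - qIm2 x * qIm1 y + qIm3 x * qRe y"

primcorec scaleR_quat where
  "qRe (scaleR r x) = r * qRe x"
| "qIm1 (scaleR r x) = r * qIm1 x"
| "qIm2 (scaleR r x) = r * qIm2 x"
| "qIm3 (scaleR r x) = r * qIm3 x"

instance
  by standard (simp_all add: quat_eq_iff algebra_simps)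

end

primcorec qcnj :: "quat \<Rightarrow> quat" where
  "qRe (qcnj x) = qRe x"
| "qIm1 (qcnj x) = - qIm1 x"
| "qIm2 (qcnj x) = - qIm2 x"
| "qIm3 (qcnj x) = - qIm3 x"

instantiation quat :: real_normed_div_algebra
begin

definition norm_quat :: "quat \<Rightarrow> real" where
  "norm x = sqrt ((qRe x)\<^sup>2 + (qIm1 x)\<^sup>2 + (qIm2 x)\<^sup>2 + (qIm3 x)\<^sup>2)"

definition inverse_quat :: "quat \<Rightarrow> quat" where
  "inverse x = scaleR (1 / (norm x)\<^sup>2) (qcnj x)"

definition divide_quat :: "quat \<Rightarrow> quat \<Rightarrow> quat" where
  "x div y = x * inverse y" for x y :: quat

definition sgn_quat :: "quat \<Rightarrow> quat" where
  "sgn x = scaleR (inverse (norm x)) x" for x :: quat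

definition dist_quat :: "quat \<Rightarrow> quat \<Rightarrow> real" where
  "dist x y = norm (x - y)" for x y :: quat

definition uniformity_quat :: "(quat \<times> quat) filter" where
  "uniformity_quat = (INF e\<in>{0 <..}. principal {(x, y). dist x y < e})"

definition open_quat :: "quat set \<Rightarrow> bool" where
  "open_quat U \<longleftrightarrow> (\<forall>x\<in>U. eventually (\<lambda>(x', y). x' = x \<longrightarrow> y \<in> U) uniformity)"

instance
proof
  fix r :: real and x y :: quat and U :: "quat set"
  have norm_eq: "norm z = norm ((qRe z, qIm1 z), (qIm2 z, qIm3 z))" for z :: quat
    by (simp add: norm_quat_def norm_Pair add.assoc)
  have norm_sq: "(norm z)\<^sup>2 = (qRe z)\<^sup>2 + (qIm1 z)\<^sup>2 + (qIm2 z)\<^sup>2 + (qIm3 z)\<^sup>2" for z :: quat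
    by (simp add: norm_quat_def)
  show norm0: "norm x = 0 \<longleftrightarrow> x = 0" for x :: quat
    by (simp add: norm_eq quat_eq_iff zero_prod_def)
  show "norm (x + y) \<le> norm x + norm y"
    using norm_triangle_ineq[of "((qRe x, qIm1 x), (qIm2 x, qIm3 x))"
        "((qRe y, qIm1 y), (qIm2 y, qIm3 y))"]
    by (simp add: norm_eq)
  show "norm (r *\<^sub>R x) = \<bar>r\<bar> * norm x"
    using norm_scaleR[of r "((qRe x, qIm1 x), (qIm2 x, qIm3 x))"]
    by (simp add: norm_eq del: norm_scaleR)
  show "norm (x * y) = norm x * norm y"
    unfolding norm_quat_def real_sqrt_mult[symmetric]
    by (simp add: power2_eq_square algebra_simps)
  have cnj: "x * qcnj x = ((norm x)\<^sup>2) *\<^sub>R 1" "qcnj x * x = ((norm x)\<^sup>2) *\<^sub>R 1" for x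
    unfolding norm_sq by (simp_all add: quat_eq_iff power2_eq_square algebra_simps)
  show "inverse x * x = 1" "x * inverse x = 1" if "x \<noteq> 0"
    using that norm0[of x] by (simp_all add: inverse_quat_def cnj)
  show "inverse (0::quat) = 0"
    by (simp add: inverse_quat_def quat_eq_iff)
qed (rule divide_quat_def sgn_quat_def dist_quat_def uniformity_quat_def open_quat_def)+

end

definition similarity_class :: "quat \<Rightarrow> quat set" where
  "similarity_class q = {h * q * inverse h | h. h \<noteq> 0}"


section \<open>Right quaternionic Hilbert spaces\<close>

text \<open>
  The real normed structure underlying a right quaternionic Hilbert space is determined by the
  quaternionic one through \<open>scaleR_eq\<close> and \<open>norm_eq\<close>; the norm axioms inherited from
  \<^class>\<open>banach\<close> follow from those of the inner product, so of this superclass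
  only completeness is an additional requirement.
\<close>

class right_quat_hilbert = banach +
  fixes qscale :: "'a \<Rightarrow> quat \<Rightarrow> 'a"  (infixl \<open>\<cdot>\<^sub>H\<close> 75)
    and qinner :: "'a \<Rightarrow> 'a \<Rightarrow> quat"
  assumes qscale_add_left: "(x + y) \<cdot>\<^sub>H p = x \<cdot>\<^sub>H p + y \<cdot>\<^sub>H p"
    and qscale_add_right: "x \<cdot>\<^sub>H (p + q) = x \<cdot>\<^sub>H p + x \<cdot>\<^sub>H q"
    and qscale_assoc: "(x \<cdot>\<^sub>H p) \<cdot>\<^sub>H q = x \<cdot>\<^sub>H (p * q)"
    and qscale_one: "x \<cdot>\<^sub>H 1 = x"
    and scaleR_eq: "r *\<^sub>R x = x \<cdot>\<^sub>H of_real r"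
    and qinner_right: "qinner f (g \<cdot>\<^sub>H q + h) = qinner f g * q + qinner f h"
    and qinner_commute: "qinner f g = qcnj (qinner g f)"
    and qinner_self_nonneg: "\<exists>r\<ge>0. qinner f f = of_real r"
    and qinner_self_eq_0: "qinner f f = 0 \<Longrightarrow> f = 0"
    and norm_eq: "norm f = sqrt (qRe (qinner f f))"

definition right_subspace :: "'a::right_quat_hilbert set \<Rightarrow> bool" where
  "right_subspace W \<longleftrightarrow>
     0 \<in> W \<and> (\<forall>x\<in>W. \<forall>y\<in>W. x + y \<in> W) \<and> (\<forall>x\<in>W. \<forall>q. x \<cdot>\<^sub>H q \<in> W)"

definition finite_dim :: "'a::right_quat_hilbert set \<Rightarrow> bool" where
  "finite_dim W \<longleftrightarrow> (\<exists>B. finite B \<and> right_subspace hull B = W)"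


section \<open>Bounded and compact operators\<close>

definition right_linear_on :: "'a::right_quat_hilbert set \<Rightarrow> ('a \<Rightarrow> 'a) \<Rightarrow> bool" where
  "right_linear_on W f \<longleftrightarrow>
     (\<forall>x\<in>W. \<forall>y\<in>W. f (x + y) = f x + f y) \<and> (\<forall>x\<in>W. \<forall>q. f (x \<cdot>\<^sub>H q) = f x \<cdot>\<^sub>H q)"

text \<open>
  The ring \<open>\<B>(W)\<close> for a subspace \<open>W\<close>. Operators on \<open>W\<close> are represented by functions that are
  \<^const>\<open>undefined\<close> outside \<open>W\<close>, so that equality in the ring is equality on \<open>W\<close>.
\<close>

definition bounded_ops :: "'a::right_quat_hilbert set \<Rightarrow> ('a \<Rightarrow> 'a) ring" where
  "bounded_ops W =
     \<lparr>carrier = {f \<in> W \<rightarrow>\<^sub>E W. right_linear_on W f \<and> (\<exists>K. \<forall>x\<in>W. norm (f x) \<le> K * norm x)},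
      monoid.mult = compose W,
      one = (\<lambda>x\<in>W. x),
      zero = (\<lambda>x\<in>W. 0),
      add = (\<lambda>f g. \<lambda>x\<in>W. f x + g x)\<rparr>"

definition compact_ops :: "('a::right_quat_hilbert \<Rightarrow> 'a) set" where
  "compact_ops = {f \<in> carrier (bounded_ops UNIV). compact (closure (f ` cball 0 1))}"

lemma right_subspace_diff:
  assumes "right_subspace W" "x \<in> W" "y \<in> W"
  shows "x - y \<in> W" "- x \<in> W" "r *\<^sub>R x \<in> W"
proof -
  have *: "r *\<^sub>R z \<in> W" if "z \<in> W" for r z
    using assms(1) that by (simp add: right_subspace_def scaleR_eq)
  show "r *\<^sub>R x \<in> W"
    using * assms(2) .
  show "- x \<in> W"
    using *[of x "-1"] assms by simp
  show "x - y \<in> W"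
    using *[of y "-1"] assms(1,2,3) unfolding right_subspace_def
    by (metis add_uminus_conv_diff scaleR_minus1_left)
qed

lemma qscale_minus_left: "(- x) \<cdot>\<^sub>H q = - (x \<cdot>\<^sub>H q)" for x :: "'a::right_quat_hilbert"
proof -
  have "(0::'a) \<cdot>\<^sub>H q = 0"
    using qscale_add_left[of "0::'a" 0 q] by simp
  then show ?thesis
    using qscale_add_left[of x "- x" q] by (simp add: minus_unique)
qed

lemma ring_bounded_ops:
  fixes W :: "'a::right_quat_hilbert set"
  assumes W: "right_subspace W"
  shows "ring (bounded_ops W)"
proof -
  note W' = W[unfolded right_subspace_def]
  have carrI: "f \<in> carrier (bounded_ops W)"
    if "f \<in> W \<rightarrow>\<^sub>E W" "right_linear_on W f" "\<And>x. x \<in> W \<Longrightarrow> norm (f x) \<le> K * norm x" for f K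
    using that by (auto simp: bounded_ops_def)
  have carrE: "\<exists>K\<ge>0. f \<in> W \<rightarrow>\<^sub>E W \<and> right_linear_on W f \<and> (\<forall>x\<in>W. norm (f x) \<le> K * norm x)"
    if "f \<in> carrier (bounded_ops W)" for f
  proof -
    from that obtain K where K: "f \<in> W \<rightarrow>\<^sub>E W" "right_linear_on W f"
      "\<forall>x\<in>W. norm (f x) \<le> K * norm x"
      by (auto simp: bounded_ops_def)
    have "\<forall>x\<in>W. norm (f x) \<le> \<bar>K\<bar> * norm x"
      using K(3) by (meson abs_ge_self mult_right_mono norm_ge_zero order_trans)
    then show ?thesis
      using K by (intro exI[of _ "\<bar>K\<bar>"]) auto
  qed
  have compose_closed: "compose W f g \<in> carrier (bounded_ops W)"
    if "f \<in> carrier (bounded_ops W)" "g \<in> carrier (bounded_ops W)" for f g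
  proof -
    from carrE[OF that(1)] obtain K where K: "K \<ge> 0" "f \<in> W \<rightarrow>\<^sub>E W" "right_linear_on W f"
      "\<forall>x\<in>W. norm (f x) \<le> K * norm x" by blast
    from carrE[OF that(2)] obtain L where L: "L \<ge> 0" "g \<in> W \<rightarrow>\<^sub>E W" "right_linear_on W g"
      "\<forall>x\<in>W. norm (g x) \<le> L * norm x" by blast
    show ?thesis
    proof (rule carrI)
      show "compose W f g \<in> W \<rightarrow>\<^sub>E W" using K(2) L(2) by (auto simp: compose_def)
      show "right_linear_on W (compose W f g)"
        using K(2,3) L(2,3) W' by (auto simp: compose_def right_linear_on_def PiE_mem)
      fix x assume x: "x \<in> W"
      have "norm (f (g x)) \<le> K * norm (g x)" using K(4) L(2) x by (auto simp: PiE_mem)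
      also have "\<dots> \<le> K * (L * norm x)" using K(1) L(4) x by (simp add: mult_left_mono)
      finally show "norm (compose W f g x) \<le> (K * L) * norm x"
        using x by (simp add: compose_def mult.assoc)
    qed
  qed
  have add_closed: "(\<lambda>x\<in>W. f x + g x) \<in> carrier (bounded_ops W)"
    if "f \<in> carrier (bounded_ops W)" "g \<in> carrier (bounded_ops W)" for f g
  proof -
    from carrE[OF that(1)] obtain K where K: "K \<ge> 0" "f \<in> W \<rightarrow>\<^sub>E W" "right_linear_on W f"
      "\<forall>x\<in>W. norm (f x) \<le> K * norm x" by blast
    from carrE[OF that(2)] obtain L where L: "L \<ge> 0" "g \<in> W \<rightarrow>\<^sub>E W" "right_linear_on W g"
      "\<forall>x\<in>W. norm (g x) \<le> L * norm x" by blast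
    show ?thesis
    proof (rule carrI)
      show "(\<lambda>x\<in>W. f x + g x) \<in> W \<rightarrow>\<^sub>E W" using K(2) L(2) W' by (auto simp: PiE_mem)
      show "right_linear_on W (\<lambda>x\<in>W. f x + g x)"
        using K(2,3) L(2,3) W'
        by (auto simp: right_linear_on_def PiE_mem qscale_add_left algebra_simps)
      fix x assume x: "x \<in> W"
      have "norm (f x + g x) \<le> norm (f x) + norm (g x)" by (rule norm_triangle_ineq)
      also have "\<dots> \<le> K * norm x + L * norm x" using K(4) L(4) x by (intro add_mono) auto
      finally show "norm ((\<lambda>x\<in>W. f x + g x) x) \<le> (K + L) * norm x"
        using x by (simp add: algebra_simps)
    qed
  qed
  have zero_closed: "(\<lambda>x\<in>W. 0) \<in> carrier (bounded_ops W)"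
    using W' qscale_minus_left[of "0::'a"] qscale_add_left[of "0::'a" 0]
    by (intro carrI[of _ 0]) (auto simp: right_linear_on_def)
  have one_closed: "(\<lambda>x\<in>W. x) \<in> carrier (bounded_ops W)"
    using W' by (intro carrI[of _ 1]) (auto simp: right_linear_on_def)
  have neg_closed: "(\<lambda>x\<in>W. - f x) \<in> carrier (bounded_ops W)"
    if "f \<in> carrier (bounded_ops W)" for f
  proof -
    from carrE[OF that(1)] obtain K where K: "K \<ge> 0" "f \<in> W \<rightarrow>\<^sub>E W" "right_linear_on W f"
      "\<forall>x\<in>W. norm (f x) \<le> K * norm x" by blast
    show ?thesis
      using K W' right_subspace_diff(2)[OF W]
      by (intro carrI[of _ K]) (auto simp: right_linear_on_def PiE_mem qscale_minus_left)
  qed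
  have fW: "f x \<in> W" if "f \<in> carrier (bounded_ops W)" "x \<in> W" for f x
    using carrE[OF that(1)] that(2) by (auto simp: PiE_mem)
  have ext: "f x = undefined" if "f \<in> carrier (bounded_ops W)" "x \<notin> W" for f x
    using that by (simp add: bounded_ops_def PiE_def extensional_def)
  have lin: "f (x + y) = f x + f y" if "f \<in> carrier (bounded_ops W)" "x \<in> W" "y \<in> W" for f x y
    using carrE[OF that(1)] that(2,3) by (auto simp: right_linear_on_def)
  have sel: "mult (bounded_ops W) = compose W" "one (bounded_ops W) = (\<lambda>x\<in>W. x)"
    "zero (bounded_ops W) = (\<lambda>x\<in>W. 0)"
    "add (bounded_ops W) = (\<lambda>f g. \<lambda>x\<in>W. f x + g x)"
    by (simp_all add: bounded_ops_def)
  show ?thesis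
  proof (rule ringI)
    show "abelian_group (bounded_ops W)"
    proof (rule abelian_groupI)
      fix f assume f: "f \<in> carrier (bounded_ops W)"
      show "\<exists>g\<in>carrier (bounded_ops W). add (bounded_ops W) g f = zero (bounded_ops W)"
        using neg_closed[OF f] by (rule bexI[rotated]) (auto simp: sel restrict_def)
    qed (use W' in \<open>auto simp: sel add_closed zero_closed fun_eq_iff ext add_ac\<close>)
    show "Group.monoid (bounded_ops W)"
    proof (rule monoidI)
    qed (auto simp: sel compose_closed one_closed, auto simp: fun_eq_iff ext fW compose_def)
  qed (use W' in \<open>auto simp: sel fun_eq_iff fW lin compose_def restrict_def\<close>)
qed

lemma ideal_compact_ops: "ideal (compact_ops :: ('a::right_quat_hilbert \<Rightarrow> 'a) set) (bounded_ops UNIV)"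
proof -
  let ?B = "bounded_ops UNIV :: ('a \<Rightarrow> 'a) ring"
  interpret B: ring ?B
    by (rule ring_bounded_ops) (simp add: right_subspace_def)
  have sel: "mult ?B = (\<lambda>f g. f \<circ> g)" "one ?B = (\<lambda>x. x)"
    "zero ?B = (\<lambda>x. 0)" "add ?B = (\<lambda>f g x. f x + g x)"
    by (simp_all add: bounded_ops_def compose_def o_def fun_eq_iff)
  have blin: "bounded_linear f" if "f \<in> carrier ?B" for f
  proof -
    from that obtain K where K: "right_linear_on UNIV f" "\<forall>x. norm (f x) \<le> K * norm x"
      by (auto simp: bounded_ops_def)
    show ?thesis
      using K by (intro bounded_linear_intro[where K = K])
        (auto simp: right_linear_on_def scaleR_eq mult.commute)
  qed
  have compI: "compact (closure S)" if "S \<subseteq> C" "compact C" for S C :: "'a set"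
  proof -
    have "closure S \<subseteq> C"
      using that by (simp add: closure_minimal compact_imp_closed)
    then show ?thesis
      using compact_Int_closed[OF that(2) closed_closure[of S]] by (simp add: Int_absorb1)
  qed
  show ?thesis
  proof (rule idealI)
    show "subgroup compact_ops (add_monoid ?B)"
    proof (rule B.add.subgroupI)
      show "compact_ops \<subseteq> carrier ?B" by (auto simp: compact_ops_def)
      have "zero ?B \<in> compact_ops"
        using B.zero_closed by (auto simp: compact_ops_def sel image_constant_conv)
      then show "compact_ops \<noteq> ({} :: ('a \<Rightarrow> 'a) set)" by blast
    next
      fix f assume f: "f \<in> (compact_ops :: ('a \<Rightarrow> 'a) set)"
      have fc: "f \<in> carrier ?B" and c: "compact (closure (f ` cball 0 1))"
        using f by (auto simp: compact_ops_def)
      have "add ?B (a_inv ?B f) f = zero ?B" using fc by (rule B.l_neg)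
      then have eq: "a_inv ?B f = (\<lambda>x. - f x)"
        by (auto simp: sel fun_eq_iff eq_neg_iff_add_eq_0)
      have "(\<lambda>x. - f x) ` cball 0 1 \<subseteq> uminus ` closure (f ` cball 0 1)"
        using closure_subset by fastforce
      then have "compact (closure ((\<lambda>x. - f x) ` cball 0 1))"
        using compact_negations[OF c] by (rule compI)
      then show "a_inv ?B f \<in> compact_ops"
        using B.a_inv_closed[OF fc] by (simp add: compact_ops_def eq)
    next
      fix f g assume fg: "f \<in> (compact_ops :: ('a \<Rightarrow> 'a) set)" "g \<in> (compact_ops :: ('a \<Rightarrow> 'a) set)"
      let ?C = "closure (f ` cball 0 1)" and ?D = "closure (g ` cball 0 1)"
      have c: "compact {x + y | x y. x \<in> ?C \<and> y \<in> ?D}"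
        using fg by (intro compact_sums) (auto simp: compact_ops_def)
      have "(\<lambda>x. f x + g x) ` cball 0 1 \<subseteq> {x + y | x y. x \<in> ?C \<and> y \<in> ?D}"
        using closure_subset[of "f ` cball 0 1"] closure_subset[of "g ` cball 0 1"] by blast
      then have "compact (closure ((\<lambda>x. f x + g x) ` cball 0 1))"
        using c by (rule compI)
      then show "add ?B f g \<in> compact_ops"
        using fg B.a_closed[of f g] by (simp add: compact_ops_def sel)
    qed
  next
    fix f g assume f: "f \<in> (compact_ops :: ('a \<Rightarrow> 'a) set)" and g: "g \<in> carrier ?B"
    have fc: "f \<in> carrier ?B" and c: "compact (closure (f ` cball 0 1))"
      using f by (auto simp: compact_ops_def)
    have "(g \<circ> f) ` cball 0 1 \<subseteq> g ` closure (f ` cball 0 1)"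
      using closure_subset by fastforce
    moreover have "compact (g ` closure (f ` cball 0 1))"
      using c blin[OF g] by (intro compact_continuous_image linear_continuous_on)
    ultimately have "compact (closure ((g \<circ> f) ` cball 0 1))" by (rule compI)
    then show "mult ?B g f \<in> compact_ops"
      using B.m_closed[OF g fc] by (simp add: compact_ops_def sel)
    obtain K where K: "\<And>x. norm (g x) \<le> K * norm x" "K > 0"
      using bounded_linear.pos_bounded[OF blin[OF g]] by (auto simp: mult.commute)
    interpret f: bounded_linear f by (rule blin[OF fc])
    have "(f \<circ> g) ` cball 0 1 \<subseteq> (\<lambda>x. K *\<^sub>R x) ` closure (f ` cball 0 1)"
    proof
      fix y assume "y \<in> (f \<circ> g) ` cball 0 1"
      then obtain x where x: "norm x \<le> 1" "y = f (g x)" by auto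
      have "norm (g x) \<le> K" using K(1)[of x] x(1) K(2)
        by (meson mult_left_le order_less_imp_le order_trans)
      then have "(1 / K) *\<^sub>R g x \<in> cball 0 1" using K(2) by (simp add: divide_simps)
      then have "f ((1 / K) *\<^sub>R g x) \<in> closure (f ` cball 0 1)"
        by (intro subsetD[OF closure_subset] imageI)
      moreover have "y = K *\<^sub>R f ((1 / K) *\<^sub>R g x)"
        using K(2) x(2) by (simp add: f.scaleR)
      ultimately show "y \<in> (\<lambda>x. K *\<^sub>R x) ` closure (f ` cball 0 1)"
        by (intro image_eqI)
    qed
    then have "compact (closure ((f \<circ> g) ` cball 0 1))"
      using compact_scaling[OF c] by (rule compI)
    then show "mult ?B f g \<in> compact_ops"
      using B.m_closed[OF fc g] by (simp add: compact_ops_def sel)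
  qed (rule B.ring_axioms)
qed

definition calkin_algebra :: "('a::right_quat_hilbert \<Rightarrow> 'a) set ring" where
  "calkin_algebra = bounded_ops UNIV Quot compact_ops"


section \<open>The S-spectrum\<close>

text \<open>
  In \<open>Q_op W T q\<close> and \<open>S_spectrum W T\<close>, \<open>T\<close> is an operator on \<open>W\<close>; the whole space is
  \<open>W = UNIV\<close>.
\<close>

definition Q_op :: "'a::right_quat_hilbert set \<Rightarrow> ('a \<Rightarrow> 'a) \<Rightarrow> quat \<Rightarrow> 'a \<Rightarrow> 'a" where
  "Q_op W T q = (\<lambda>x\<in>W. T (T x) - (2 * qRe q) *\<^sub>R T x + (norm q)\<^sup>2 *\<^sub>R x)"

definition S_spectrum :: "'a::right_quat_hilbert set \<Rightarrow> ('a \<Rightarrow> 'a) \<Rightarrow> quat set" where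
  "S_spectrum W T = {q. Q_op W T q \<notin> Units (bounded_ops W)}"

definition essential_S_spectrum :: "('a::right_quat_hilbert \<Rightarrow> 'a) \<Rightarrow> quat set" where
  "essential_S_spectrum T =
     {q. compact_ops +>\<^bsub>bounded_ops UNIV\<^esub> Q_op UNIV T q \<notin> Units calkin_algebra}"

definition eigenvalue_of_finite_type :: "('a::right_quat_hilbert \<Rightarrow> 'a) \<Rightarrow> quat \<Rightarrow> bool" where
  "eigenvalue_of_finite_type T q \<longleftrightarrow>
     q \<in> S_spectrum UNIV T \<and>
     (\<exists>V\<^sub>1 V\<^sub>2.
        right_subspace V\<^sub>1 \<and> closed V\<^sub>1 \<and> T ` V\<^sub>1 \<subseteq> V\<^sub>1 \<and>
        right_subspace V\<^sub>2 \<and> closed V\<^sub>2 \<and> T ` V\<^sub>2 \<subseteq> V\<^sub>2 \<and>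
        V\<^sub>1 \<inter> V\<^sub>2 = {0} \<and> {x + y | x y. x \<in> V\<^sub>1 \<and> y \<in> V\<^sub>2} = UNIV \<and>
        finite_dim V\<^sub>1 \<and>
        S_spectrum V\<^sub>1 (restrict T V\<^sub>1) \<inter> S_spectrum V\<^sub>2 (restrict T V\<^sub>2) = {} \<and>
        S_spectrum V\<^sub>1 (restrict T V\<^sub>1) = similarity_class q)"

definition discrete_S_spectrum :: "('a::right_quat_hilbert \<Rightarrow> 'a) \<Rightarrow> quat set" where
  "discrete_S_spectrum T = {q. eigenvalue_of_finite_type T q}"

end

(* If q is an eigenvalue of finite type with decomposition V = V1 + V2, then q lies in the
   S-spectrum of T on V1, hence not in that of T on V2, so Q_q(T) is invertible on V2.
   The projection P onto V1 along V2 is bounded and compact because V1 has compact balls.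
   Extending the inverse on V2 by 0 on V1 gives an inverse of Q_q(T) modulo P, that is, an inverse
   in the Calkin algebra. *)
theory Submission
  imports Defs
begin

section \<open>Compact balls and an angle bound in real normed spaces\<close>

text \<open>Induction on \<open>B\<close>. A new vector \<open>b\<close> outside
  \<open>span B\<close> has positive distance from \<open>span B\<close>, which bounds the
  coefficient of \<open>b\<close> in any vector of norm at most \<open>r\<close>. The ball in the
  larger span is then a continuous image of a compact set of pairs (vector of \<open>span B\<close>,
  coefficient).\<close>

lemma compact_span_Int_cball:
  fixes B :: "'a::real_normed_vector set"
  assumes "finite B"
  shows "compact (span B \<inter> cball 0 r)"
  using assms
proof (induction B arbitrary: r rule: finite_induct)
  case empty
  have "finite (span {} \<inter> cball (0::'a) r)"
    by simp
  then show ?case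
    by (rule finite_imp_compact)
next
  case (insert b B)
  show ?case
  proof (cases "b \<in> span B")
    case True
    then show ?thesis
      using insert.IH by (simp add: span_redundant)
  next
    case False
    \<comment> \<open>The induction hypothesis gives closedness only for bounded pieces of
      \<open>span B\<close>. Radius \<open>norm b + 1\<close> suffices: points of larger norm are at
      distance at least 1 from \<open>b\<close>, hence the minimum with 1 in
      \<open>e\<close>.\<close>
    have "closed (span B \<inter> cball 0 (norm b + 1))"
      using insert.IH by (rule compact_imp_closed)
    then obtain d where "d > 0" "ball b d \<subseteq> - (span B \<inter> cball 0 (norm b + 1))"
      using False openE[of "- (span B \<inter> cball 0 (norm b + 1))" b] by blast
    then have d: "d > 0" "\<And>w. w \<in> span B \<inter> cball 0 (norm b + 1) \<Longrightarrow> d \<le> dist b w"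
      by (auto simp: subset_iff not_less[symmetric])
    define e where "e = min d 1"
    have e: "e > 0"
      using d by (simp add: e_def)
    have e_le: "e \<le> norm (b - w)" if "w \<in> span B" for w
    proof (cases "norm w \<le> norm b + 1")
      case True
      then show ?thesis
        using d(2)[of w] that by (simp add: e_def dist_norm)
    next
      case False
      then have "1 \<le> norm (b - w)"
        using norm_triangle_ineq2[of w b] by (simp add: norm_minus_commute)
      then show ?thesis
        by (simp add: e_def)
    qed
    \<comment> \<open>For nonzero \<open>t\<close>, \<open>w + t *\<^sub>R b\<close> is
      \<open>t\<close> times the difference of \<open>b\<close> and a vector of
      \<open>span B\<close>.\<close>
    have t_le: "\<bar>t\<bar> * e \<le> norm (w + t *\<^sub>R b)" if "w \<in> span B" for w t
    proof (cases "t = 0")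
      case False
      have "e \<le> norm (b - (- inverse t) *\<^sub>R w)"
        using that by (intro e_le span_scale)
      then have "\<bar>t\<bar> * e \<le> norm (t *\<^sub>R (b - (- inverse t) *\<^sub>R w))"
        by (simp add: mult_left_mono)
      also have "t *\<^sub>R (b - (- inverse t) *\<^sub>R w) = w + t *\<^sub>R b"
        using False by (simp add: algebra_simps)
      finally show ?thesis .
    qed simp
    \<comment> \<open>If \<open>w + t *\<^sub>R b\<close> has norm at most \<open>r\<close>, then
      \<open>t_le\<close> gives \<bar>t\<bar> \<le> R, and the triangle inequality bounds
      \<open>norm w\<close> by \<open>r + R * norm b\<close>. So \<open>K\<close> contains every
      pair needed to reach the ball; intersecting with the preimage under \<open>F\<close> discards
      the pairs that land outside it.\<close>
    define R where "R = r / e"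
    define K where "K = (span B \<inter> cball 0 (r + R * norm b)) \<times> {- R..R}"
    define F where "F = (\<lambda>(w, t). w + t *\<^sub>R b :: 'a)"
    have contF: "continuous_on UNIV F"
      unfolding F_def case_prod_unfold by (intro continuous_intros)
    have "compact K"
      unfolding K_def by (intro compact_Times insert.IH compact_Icc)
    moreover have "closed (F -` cball 0 r)"
      using contF by (intro continuous_closed_vimage) (auto simp: continuous_on_eq_continuous_at)
    ultimately have "compact (K \<inter> F -` cball 0 r)"
      by (rule compact_Int_closed)
    then have "compact (F ` (K \<inter> F -` cball 0 r))"
      using contF by (intro compact_continuous_image) (auto intro: continuous_on_subset)
    moreover have "F ` (K \<inter> F -` cball 0 r) = span (insert b B) \<inter> cball 0 r"
    proof (intro equalityI subsetI)
      fix x assume "x \<in> F ` (K \<inter> F -` cball 0 r)"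
      then obtain w t where x: "x = w + t *\<^sub>R b" "w \<in> span B" "norm x \<le> r"
        by (auto simp: F_def K_def)
      have "w \<in> span (insert b B)"
        using x(2) subsetD[OF span_mono[of B "insert b B"]] by blast
      then have "x \<in> span (insert b B)"
        by (simp add: x(1) span_add span_scale span_base)
      then show "x \<in> span (insert b B) \<inter> cball 0 r"
        using x by simp
    next
      fix x assume x: "x \<in> span (insert b B) \<inter> cball 0 r"
      then obtain t where t: "x - t *\<^sub>R b \<in> span B"
        by (auto simp: span_insert)
      have "\<bar>t\<bar> * e \<le> r"
        using t_le[OF t, of t] x by simp
      then have tR: "\<bar>t\<bar> \<le> R"
        using e by (simp add: R_def pos_le_divide_eq)
      have "norm (x - t *\<^sub>R b) \<le> norm x + \<bar>t\<bar> * norm b"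
        using norm_triangle_ineq4[of x "t *\<^sub>R b"] by simp
      also have "\<dots> \<le> r + R * norm b"
        using x tR by (intro add_mono mult_right_mono) auto
      finally have "(x - t *\<^sub>R b, t) \<in> K \<inter> F -` cball 0 r"
        using t tR x by (auto simp: K_def F_def)
      then show "x \<in> F ` (K \<inter> F -` cball 0 r)"
        by (intro image_eqI[of _ _ "(x - t *\<^sub>R b, t)"]) (simp_all add: F_def)
    qed
    ultimately show ?thesis
      by simp
  qed
qed

text \<open>The differences between the compact unit sphere of \<open>V\<close> and the closed set
  \<open>W\<close> form a closed set, which misses 0 because \<open>V\<close> and \<open>W\<close>
  meet trivially. The radius of a ball around 0 that avoids this set serves as \<open>c\<close>. The
  estimate bounds the projection onto \<open>V\<close> along \<open>W\<close> by
  \<open>1 / c\<close>.\<close>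

lemma norm_add_ge_of_Int_trivial:
  fixes V W :: "'a::real_normed_vector set"
  assumes "subspace V" "subspace W" "closed W" "compact (V \<inter> cball 0 1)" "V \<inter> W \<subseteq> {0}"
  obtains c where "c > 0" "\<And>x y. x \<in> V \<Longrightarrow> y \<in> W \<Longrightarrow> c * norm x \<le> norm (x + y)"
proof -
  have eq: "V \<inter> sphere 0 1 = (V \<inter> cball 0 1) \<inter> sphere 0 1"
    by auto
  have "closed (sphere (0::'a) 1)"
    unfolding sphere_def by (intro closed_Collect_eq continuous_intros)
  with assms(4) have "compact (V \<inter> sphere 0 1)"
    unfolding eq by (rule compact_Int_closed)
  then have "open (- (\<Union>x\<in>V \<inter> sphere 0 1. \<Union>y\<in>W. {x - y}))" (is "open (- ?D)")
    using assms(3) by (intro open_Compl compact_closed_differences)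
  moreover have "0 \<in> - ?D"
    using assms(5) by auto
  ultimately obtain d where d: "d > 0" and disj: "ball 0 d \<subseteq> - ?D"
    by (rule openE)
  have le_dist: "d \<le> dist x y" if "x \<in> V \<inter> sphere 0 1" "y \<in> W" for x y
  proof -
    have "x - y \<notin> ball 0 d"
      using disj that by blast
    then show ?thesis
      by (simp add: dist_norm norm_minus_commute)
  qed
  have "d * norm x \<le> norm (x + y)" if "x \<in> V" "y \<in> W" for x y
  proof (cases "x = 0")
    case False
    \<comment> \<open>Normalise \<open>x\<close>; the sign on \<open>y\<close> turns a distance
      between points of the two subspaces into the norm of a sum.\<close>
    have "(1 / norm x) *\<^sub>R x \<in> V \<inter> sphere 0 1" "(- (1 / norm x)) *\<^sub>R y \<in> W"
      using subspace_scale[OF assms(1) that(1)] subspace_scale[OF assms(2) that(2)] False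
      by (simp_all del: scaleR_minus_left)
    then have "d \<le> dist ((1 / norm x) *\<^sub>R x) ((- (1 / norm x)) *\<^sub>R y)"
      by (rule le_dist)
    also have "\<dots> = norm ((1 / norm x) *\<^sub>R (x + y))"
      by (simp only: dist_norm scaleR_add_right scaleR_minus_left diff_minus_eq_add)
    also have "\<dots> = norm (x + y) / norm x"
      by simp
    finally show ?thesis
      using False by (simp add: pos_le_divide_eq)
  qed simp
  with d show thesis
    by (rule that)
qed

section \<open>From quaternionic to real subspaces\<close>

lemma subspace_of_right_subspace: "right_subspace W \<Longrightarrow> subspace W"
  by (simp add: subspace_def right_subspace_def scaleR_eq)

lemma qscale_zero_left: "(0::'a::right_quat_hilbert) \<cdot>\<^sub>H q = 0"
  using qscale_add_left[of "0::'a" 0 q] by simp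

lemma qscale_scaleR_right: "x \<cdot>\<^sub>H (r *\<^sub>R q) = r *\<^sub>R (x \<cdot>\<^sub>H q)"
  for x :: "'a::right_quat_hilbert"
  by (simp add: scaleR_eq qscale_assoc of_real_def)

lemma qscale_scaleR_left: "(r *\<^sub>R x) \<cdot>\<^sub>H q = r *\<^sub>R (x \<cdot>\<^sub>H q)"
  for x :: "'a::right_quat_hilbert"
  by (simp add: scaleR_eq qscale_assoc of_real_def)

text \<open>The real basis 1, i, j, k of the quaternions. Multiplying a finite quaternionic
  generating set by it yields a finite real one.\<close>

definition qbasis :: "quat set" where
  "qbasis = {Quat 1 0 0 0, Quat 0 1 0 0, Quat 0 0 1 0, Quat 0 0 0 1}"

lemma span_qbasis: "q \<in> span qbasis"
proof -
  have "q = qRe q *\<^sub>R Quat 1 0 0 0 + qIm1 q *\<^sub>R Quat 0 1 0 0 +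
      qIm2 q *\<^sub>R Quat 0 0 1 0 + qIm3 q *\<^sub>R Quat 0 0 0 1"
    by (simp add: quat_eq_iff)
  also have "\<dots> \<in> span qbasis"
    by (intro span_add span_scale span_base) (auto simp: qbasis_def)
  finally show ?thesis .
qed

lemma qscale_in_span:
  fixes b :: "'a::right_quat_hilbert"
  assumes "b \<in> B"
  shows "b \<cdot>\<^sub>H q \<in> span ((\<lambda>(b, e). b \<cdot>\<^sub>H e) ` (B \<times> qbasis))"
  using span_qbasis[of q]
proof (induction q rule: span_induct_alt)
  case base
  have "b \<cdot>\<^sub>H 0 = 0"
    using qscale_add_right[of b 0 0] by simp
  then show ?case
    by (simp add: span_zero)
next
  case (step c e q)
  have "b \<cdot>\<^sub>H e \<in> (\<lambda>(b, e). b \<cdot>\<^sub>H e) ` (B \<times> qbasis)"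
    using assms step.hyps by (intro image_eqI[of _ _ "(b, e)"]) auto
  then show ?case
    using step.IH by (simp add: qscale_add_right qscale_scaleR_right span_add span_scale span_base)
qed

text \<open>A generator times \<open>q\<close> has the form
  \<open>b \<cdot>\<^sub>H (e * q)\<close>, again a right multiple of \<open>b\<close> and so in the
  span by \<open>qscale_in_span\<close>; real linearity extends this to all of the span.\<close>

lemma right_subspace_span_qbasis:
  fixes B :: "'a::right_quat_hilbert set"
  shows "right_subspace (span ((\<lambda>(b, e). b \<cdot>\<^sub>H e) ` (B \<times> qbasis)))" (is "right_subspace ?S")
proof -
  have "x \<cdot>\<^sub>H q \<in> ?S" if "x \<in> ?S" for x q
    using that
  proof (induction x rule: span_induct_alt)
    case base
    then show ?case
      by (simp add: qscale_zero_left span_zero)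
  next
    case (step c y z)
    then have "y \<cdot>\<^sub>H q \<in> ?S"
      by (auto simp: qscale_assoc intro: qscale_in_span)
    then show ?case
      using step by (auto simp: qscale_add_left qscale_scaleR_left intro: span_add span_scale)
  qed
  then show ?thesis
    by (auto simp: right_subspace_def span_zero intro: span_add)
qed

text \<open>A finite quaternionic generating set of \<open>V\<close> puts \<open>V\<close> inside a
  finitely generated real span, so the ball of \<open>V\<close> is a closed part of a compact
  ball.\<close>

lemma compact_finite_dim_Int_cball:
  fixes V :: "'a::right_quat_hilbert set"
  assumes "finite_dim V" "closed V"
  shows "compact (V \<inter> cball 0 r)"
proof -
  from assms(1) obtain B where B: "finite B" "right_subspace hull B = V"
    by (auto simp: finite_dim_def)
  let ?S = "span ((\<lambda>(b, e). b \<cdot>\<^sub>H e) ` (B \<times> qbasis))"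
  have "B \<subseteq> ?S"
    using qscale_in_span[of _ B 1] by (auto simp: qscale_one)
  then have "V \<subseteq> ?S"
    unfolding B(2)[symmetric] by (rule hull_minimal) (rule right_subspace_span_qbasis)
  then have "V \<inter> cball 0 r = (?S \<inter> cball 0 r) \<inter> V"
    by blast
  moreover have "compact (?S \<inter> cball 0 r)"
    using B(1) by (intro compact_span_Int_cball) (simp add: qbasis_def)
  ultimately show ?thesis
    using assms(2) compact_Int_closed by metis
qed

section \<open>Units of a quotient ring\<close>

text \<open>The coset map is a ring homomorphism that sends \<open>p\<close> and \<open>q\<close> to
  zero, so the coset of \<open>b\<close> is a two-sided inverse of the coset of
  \<open>a\<close>.\<close>

lemma (in ideal) rcos_in_Units:
  assumes ab: "a \<in> carrier R" "b \<in> carrier R" and pq: "p \<in> I" "q \<in> I"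
    and eq: "a \<otimes> b \<oplus> p = \<one>" "b \<otimes> a \<oplus> q = \<one>"
  shows "I +> a \<in> Units (R Quot I)"
proof -
  interpret Q: ring "R Quot I"
    by (rule quotient_is_ring)
  interpret h: ring_hom_ring R "R Quot I" "(+>) I"
    by (rule rcos_ring_hom_ring)
  have *: "(I +> x) \<otimes>\<^bsub>R Quot I\<^esub> (I +> y) = \<one>\<^bsub>R Quot I\<^esub>"
    if x: "x \<in> carrier R" and y: "y \<in> carrier R" and z: "z \<in> I" and e: "x \<otimes> y \<oplus> z = \<one>" for x y z
  proof -
    have zc: "z \<in> carrier R"
      using z by (rule a_Hcarr)
    have z0: "I +> z = \<zero>\<^bsub>R Quot I\<^esub>"
      using z by (simp only: FactRing_def a_rcos_const ring_record_simps)
    have xy: "(I +> x) \<otimes>\<^bsub>R Quot I\<^esub> (I +> y) \<in> carrier (R Quot I)"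
      by (rule Q.m_closed[OF h.hom_closed[OF x] h.hom_closed[OF y]])
    have "I +> (x \<otimes> y \<oplus> z) = (I +> x) \<otimes>\<^bsub>R Quot I\<^esub> (I +> y) \<oplus>\<^bsub>R Quot I\<^esub> (I +> z)"
      using x y zc by (simp only: h.hom_add h.hom_mult m_closed)
    then show ?thesis
      unfolding e z0 h.hom_one Q.r_zero[OF xy] by (rule sym)
  qed
  show ?thesis
    unfolding Units_def
  proof (intro CollectI conjI bexI)
    show "(I +> b) \<otimes>\<^bsub>R Quot I\<^esub> (I +> a) = \<one>\<^bsub>R Quot I\<^esub>"
      by (rule *[OF ab(2,1) pq(2) eq(2)])
    show "(I +> a) \<otimes>\<^bsub>R Quot I\<^esub> (I +> b) = \<one>\<^bsub>R Quot I\<^esub>"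
      by (rule *[OF ab pq(1) eq(1)])
  qed (use ab in \<open>auto intro: h.hom_closed\<close>)
qed

section \<open>Bounded operators on the whole space\<close>

lemma bounded_ops_UNIV_sel:
  "mult (bounded_ops UNIV) = (\<lambda>f g. f \<circ> g)" "one (bounded_ops UNIV) = (\<lambda>x. x)"
  "add (bounded_ops UNIV) = (\<lambda>f g x. f x + g x)"
  by (simp_all add: bounded_ops_def compose_def o_def fun_eq_iff)

lemma bounded_ops_UNIV_I:
  assumes "\<And>x y. f (x + y) = f x + f y" "\<And>x q. f (x \<cdot>\<^sub>H q) = f x \<cdot>\<^sub>H q"
    "\<And>x. norm (f x) \<le> K * norm x"
  shows "f \<in> carrier (bounded_ops UNIV)"
  using assms by (auto simp: bounded_ops_def right_linear_on_def)

lemma bounded_ops_UNIV_E: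
  assumes "f \<in> carrier (bounded_ops UNIV)"
  shows "bounded_linear f" "f (x \<cdot>\<^sub>H q) = f x \<cdot>\<^sub>H q"
proof -
  from assms obtain K where K: "right_linear_on UNIV f" "\<forall>x. norm (f x) \<le> K * norm x"
    by (auto simp: bounded_ops_def)
  show "bounded_linear f"
    using K by (intro bounded_linear_intro[where K = K])
      (auto simp: right_linear_on_def scaleR_eq mult.commute)
  show "f (x \<cdot>\<^sub>H q) = f x \<cdot>\<^sub>H q"
    using K(1) by (simp add: right_linear_on_def)
qed

text \<open>Right linearity holds because the coefficients are real, and real scaling commutes with
  right multiplication by quaternions.\<close>

lemma Q_op_in_bounded_ops:
  fixes T :: "'a::right_quat_hilbert \<Rightarrow> 'a"
  assumes T: "T \<in> carrier (bounded_ops UNIV)"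
  shows "Q_op UNIV T q \<in> carrier (bounded_ops UNIV)"
proof -
  note T' = bounded_ops_UNIV_E[OF T]
  interpret T: bounded_linear T
    by (rule T'(1))
  let ?Q = "\<lambda>x. T (T x) - (2 * qRe q) *\<^sub>R T x + (norm q)\<^sup>2 *\<^sub>R x"
  have "bounded_linear ?Q"
    by (intro bounded_linear_add bounded_linear_sub bounded_linear_const_scaleR
        bounded_linear_compose[OF T'(1)] T'(1) bounded_linear_ident)
  then interpret Q: bounded_linear ?Q .
  obtain K where K: "\<And>x. norm (?Q x) \<le> K * norm x"
    using Q.bounded by (auto simp: mult.commute)
  have minus: "(x - y) \<cdot>\<^sub>H p = x \<cdot>\<^sub>H p - y \<cdot>\<^sub>H p" for x y :: 'a and p
    using qscale_add_left[of x "- y" p] by (simp add: qscale_minus_left)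
  have "?Q \<in> carrier (bounded_ops UNIV)"
    by (rule bounded_ops_UNIV_I[OF Q.add _ K])
      (simp add: T'(2) minus qscale_add_left qscale_scaleR_left)
  then show ?thesis
    by (simp add: Q_op_def restrict_UNIV)
qed

section \<open>Inversion modulo a compact projection\<close>

text \<open>\<open>P\<close> projects onto \<open>V\<close> along \<open>W\<close>, and
  \<open>S\<close> inverts \<open>Q_op UNIV T q\<close> on \<open>W\<close> and kills
  \<open>V\<close>. Both products of the two operators are therefore the complementary projection
  onto \<open>W\<close>.\<close>

lemma Q_op_invertible_modulo_compact:
  fixes T :: "'a::right_quat_hilbert \<Rightarrow> 'a"
  assumes T: "T \<in> carrier (bounded_ops UNIV)"
    and V: "right_subspace V" "closed V" "T ` V \<subseteq> V" "finite_dim V"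
    and W: "right_subspace W" "closed W" "T ` W \<subseteq> W"
    and VW: "V \<inter> W = {0}" "{x + y | x y. x \<in> V \<and> y \<in> W} = UNIV"
    and q: "q \<notin> S_spectrum W (restrict T W)"
  obtains S P where "S \<in> carrier (bounded_ops UNIV)" "P \<in> compact_ops"
    "\<And>x. Q_op UNIV T q (S x) + P x = x" "\<And>x. S (Q_op UNIV T q x) + P x = x"
proof -
  let ?Q = "Q_op UNIV T q" and ?QW = "Q_op W (restrict T W) q"
  have Q: "?Q \<in> carrier (bounded_ops UNIV)"
    by (rule Q_op_in_bounded_ops[OF T])
  interpret Q: bounded_linear ?Q
    by (rule bounded_ops_UNIV_E(1)[OF Q])
  note V' = V(1)[unfolded right_subspace_def] and W' = W(1)[unfolded right_subspace_def]
  have QV: "?Q x \<in> V" if "x \<in> V" for x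
    using that V(3) V' right_subspace_diff[OF V(1)] by (auto simp: Q_op_def image_subset_iff)
  \<comment> \<open>\<open>restrict T W\<close> is \<open>undefined\<close> off \<open>W\<close>, so
    the agreement also needs \<open>T x\<close> to lie in \<open>W\<close>.\<close>
  have QW: "?QW x = ?Q x" "?Q x \<in> W" if "x \<in> W" for x
    using that W(3) W' right_subspace_diff[OF W(1)] by (auto simp: Q_op_def image_subset_iff)

  obtain R where R: "R \<in> carrier (bounded_ops W)"
      "compose W R ?QW = (\<lambda>x\<in>W. x)" "compose W ?QW R = (\<lambda>x\<in>W. x)"
    using q unfolding S_spectrum_def Units_def by (auto simp: bounded_ops_def)
  obtain K where RW: "\<And>x. x \<in> W \<Longrightarrow> R x \<in> W" and Rlin: "right_linear_on W R"
      and K: "\<And>x. x \<in> W \<Longrightarrow> norm (R x) \<le> K * norm x"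
    using R(1) by (auto simp: bounded_ops_def PiE_mem)
  have RQ: "R (?Q x) = x" "?Q (R x) = x" if "x \<in> W" for x
    using fun_cong[OF R(2), of x] fun_cong[OF R(3), of x] that RW[OF that]
    by (simp_all add: compose_def QW)

  obtain c where c: "c > 0" "\<And>x y. x \<in> V \<Longrightarrow> y \<in> W \<Longrightarrow> c * norm x \<le> norm (x + y)"
    using norm_add_ge_of_Int_trivial[OF subspace_of_right_subspace[OF V(1)]
        subspace_of_right_subspace[OF W(1)] W(2) compact_finite_dim_Int_cball[OF V(4,2)]] VW(1)
    by auto

  have "\<forall>z. \<exists>x. x \<in> V \<and> z - x \<in> W"
  proof
    fix z
    obtain x y where "z = x + y" "x \<in> V" "y \<in> W"
      using VW(2) by blast
    then show "\<exists>x. x \<in> V \<and> z - x \<in> W"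
      by (intro exI[of _ x]) simp
  qed
  then obtain P where P: "\<And>z. P z \<in> V" "\<And>z. z - P z \<in> W"
    by metis
  \<comment> \<open>Two decompositions of one vector differ by an element of
    \<open>V \<inter> W\<close>. This uniqueness makes the function \<open>P\<close>, obtained by
    choice, linear.\<close>
  have P_eq: "P (x + y) = x" if "x \<in> V" "y \<in> W" for x y
  proof -
    have "P (x + y) - x = y - ((x + y) - P (x + y))"
      by simp
    also have "\<dots> \<in> W"
      by (rule right_subspace_diff(1)[OF W(1) that(2) P(2)])
    finally have "P (x + y) - x \<in> V \<inter> W"
      using that P(1) right_subspace_diff(1)[OF V(1)] by blast
    then show ?thesis
      using VW(1) by simp
  qed
  define C where "C z = z - P z" for z
  have PC: "P z \<in> V" "C z \<in> W" "P z + C z = z" for z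
    using P by (simp_all add: C_def)
  have C_eq: "C (x + y) = y" if "x \<in> V" "y \<in> W" for x y
    using P_eq[OF that] by (simp add: C_def)
  \<comment> \<open>Each of the next three identities exhibits a decomposition along
    \<open>V\<close> and \<open>W\<close>, from which \<open>P_eq\<close> and \<open>C_eq\<close>
    read off the components.\<close>
  have split_add: "x + y = (P x + P y) + (C x + C y)" for x y
    by (simp add: C_def)
  have split_qscale: "x \<cdot>\<^sub>H p = P x \<cdot>\<^sub>H p + C x \<cdot>\<^sub>H p" for x p
    using PC(3)[of x] by (simp flip: qscale_add_left)
  have split_Q: "?Q x = ?Q (P x) + ?Q (C x)" for x
    using PC(3)[of x] by (simp flip: Q.add)
  have P_add: "P (x + y) = P x + P y" and C_add: "C (x + y) = C x + C y" for x y
    using P_eq[of "P x + P y" "C x + C y"] C_eq[of "P x + P y" "C x + C y"] PC V' W'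
    unfolding split_add[of x y] by simp_all
  have P_qscale: "P (x \<cdot>\<^sub>H p) = P x \<cdot>\<^sub>H p" and C_qscale: "C (x \<cdot>\<^sub>H p) = C x \<cdot>\<^sub>H p" for x p
    using P_eq[of "P x \<cdot>\<^sub>H p" "C x \<cdot>\<^sub>H p"] C_eq[of "P x \<cdot>\<^sub>H p" "C x \<cdot>\<^sub>H p"] PC V' W'
    unfolding split_qscale[of x p] by simp_all
  \<comment> \<open>\<open>?Q\<close> preserves both summands, hence commutes with \<open>C\<close>;
    the left inverse identity at the end rests on this.\<close>
  have C_Q: "C (?Q x) = ?Q (C x)" for x
    unfolding split_Q[of x] by (intro C_eq QV QW(2) PC)

  have P_norm: "norm (P x) \<le> (1 / c) * norm x" for x
    using c(2)[OF PC(1,2), of x x] c(1) unfolding PC(3) by (simp add: field_simps)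
  have C_norm: "norm (C x) \<le> (1 + 1 / c) * norm x" for x
    using norm_triangle_ineq4[of x "P x"] P_norm[of x] unfolding C_def
    by (simp add: algebra_simps)
  have P_carrier: "P \<in> carrier (bounded_ops UNIV)"
    by (rule bounded_ops_UNIV_I[OF P_add P_qscale P_norm])
  have "P ` cball 0 1 \<subseteq> V \<inter> cball 0 (1 / c)"
  proof clarify
    fix x :: 'a assume "x \<in> cball 0 1"
    then have "(1 / c) * norm x \<le> 1 / c"
      using c(1) by (simp add: field_simps)
    then show "P x \<in> V \<inter> cball 0 (1 / c)"
      using PC(1) order_trans[OF P_norm] by simp
  qed
  moreover have cV: "compact (V \<inter> cball 0 (1 / c))"
    using V(4,2) by (rule compact_finite_dim_Int_cball)
  ultimately have "closure (P ` cball 0 1) \<subseteq> V \<inter> cball 0 (1 / c)"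
    by (intro closure_minimal compact_imp_closed)
  then have "compact (closure (P ` cball 0 1))"
    using compact_Int_closed[OF cV closed_closure[of "P ` cball 0 1"]] by (simp add: Int_absorb1)
  with P_carrier have P_compact: "P \<in> compact_ops"
    by (simp add: compact_ops_def)

  \<comment> \<open>The bound \<open>K\<close> comes without a sign, so its absolute value is used
    to keep multiplication monotone.\<close>
  have "norm (R (C x)) \<le> (\<bar>K\<bar> * (1 + 1 / c)) * norm x" for x
  proof -
    have "norm (R (C x)) \<le> \<bar>K\<bar> * norm (C x)"
      using K[OF PC(2)] by (rule order_trans) (simp add: mult_right_mono)
    also have "\<dots> \<le> \<bar>K\<bar> * ((1 + 1 / c) * norm x)"
      using C_norm by (intro mult_left_mono) auto
    finally show ?thesis
      by (simp only: mult.assoc)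
  qed
  then have S_carrier: "(\<lambda>x. R (C x)) \<in> carrier (bounded_ops UNIV)"
    using Rlin PC(2)
    by (intro bounded_ops_UNIV_I) (auto simp: C_add C_qscale right_linear_on_def)
  show thesis
  proof (rule that[OF S_carrier P_compact])
    \<comment> \<open>In both sums the first term reduces to \<open>C x\<close>.\<close>
    show "?Q (R (C x)) + P x = x" "R (C (?Q x)) + P x = x" for x
      using PC by (simp_all add: RQ C_Q add.commute)
  qed
qed

section \<open>The inclusion of the spectra\<close>

theorem corollary3p11:
  fixes T :: "'a::right_quat_hilbert \<Rightarrow> 'a"
  assumes "separable_space (euclidean :: 'a topology)"
    and "\<not> finite_dim (UNIV :: 'a set)"
    and "T \<in> carrier (bounded_ops UNIV)"
  shows "essential_S_spectrum T \<subseteq> S_spectrum UNIV T - discrete_S_spectrum T"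
proof -
  let ?B = "bounded_ops UNIV :: ('a \<Rightarrow> 'a) ring"
  interpret K: ideal compact_ops ?B
    by (rule ideal_compact_ops)
  have Q: "Q_op UNIV T q \<in> carrier ?B" for q
    by (rule Q_op_in_bounded_ops[OF assms(3)])
  have "q \<notin> essential_S_spectrum T" if "q \<notin> S_spectrum UNIV T" for q
  proof -
    have u: "Q_op UNIV T q \<in> Units ?B"
      using that by (simp add: S_spectrum_def)
    \<comment> \<open>An invertible operator is invertible modulo the ideal with both remainders
      zero.\<close>
    have z: "\<zero>\<^bsub>?B\<^esub> \<in> compact_ops"
      by (rule additive_subgroup.zero_closed) (rule K.additive_subgroup_axioms)
    have "compact_ops +>\<^bsub>?B\<^esub> Q_op UNIV T q \<in> Units (?B Quot compact_ops)"
      using u by (intro K.rcos_in_Units[OF Q K.Units_inv_closed[OF u] z z]) simp_all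
    then show ?thesis
      by (simp add: essential_S_spectrum_def calkin_algebra_def)
  qed
  moreover have "q \<notin> essential_S_spectrum T" if q: "eigenvalue_of_finite_type T q" for q
  proof -
    obtain V W where V: "right_subspace V" "closed V" "T ` V \<subseteq> V" "finite_dim V"
      and W: "right_subspace W" "closed W" "T ` W \<subseteq> W"
      and VW: "V \<inter> W = {0}" "{x + y | x y. x \<in> V \<and> y \<in> W} = UNIV"
      and disj: "S_spectrum V (restrict T V) \<inter> S_spectrum W (restrict T W) = {}"
      and simcl: "S_spectrum V (restrict T V) = similarity_class q"
      using q unfolding eigenvalue_of_finite_type_def by (elim conjE exE) (rule that)
    \<comment> \<open>Conjugation by 1 fixes \<open>q\<close>, so \<open>q\<close> lies in the
      spectrum on \<open>V\<close>, and disjointness keeps it out of the spectrum on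
      \<open>W\<close>.\<close>
    have "q \<in> similarity_class q"
      unfolding similarity_class_def by (auto intro!: exI[of _ 1])
    then have "q \<notin> S_spectrum W (restrict T W)"
      using disj simcl by blast
    then obtain S P where S: "S \<in> carrier ?B" and P: "P \<in> compact_ops"
      and eq: "\<And>x. Q_op UNIV T q (S x) + P x = x" "\<And>x. S (Q_op UNIV T q x) + P x = x"
      using Q_op_invertible_modulo_compact[OF assms(3) V W VW] by blast
    have "compact_ops +>\<^bsub>?B\<^esub> Q_op UNIV T q \<in> Units (?B Quot compact_ops)"
      using eq by (intro K.rcos_in_Units[OF Q S P P]) (simp_all add: bounded_ops_UNIV_sel)
    then show ?thesis
      by (simp add: essential_S_spectrum_def calkin_algebra_def)
  qed
  ultimately show ?thesis
    by (auto simp: discrete_S_spectrum_def)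
qed

end
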